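(* Let $\alpha,r$ be complex numbers. For every real $s\geq 0$ and every integer $n\ge 0$, $$\mathcal{E}_{n}^{(s+1)}(\alpha;r)=\sum_{k=0}^{n}S_{2}(n,k,r\mid\alpha)\frac{(-1)^{k}\langle s+1\rangle_{k}}{2^{k}}.$$ When $s=0$, this becomes $$\mathcal{E}_{n}(\alpha;r)=\sum_{k=0}^{n}S_{2}(n,k,r\mid\alpha)\frac{(-1)^{k}k!}{2^{k}}.$$
   Context: All generating functions are formal power series in $t$; $(1+\alpha t)^{c/\alpha}=\exp\left(\frac{c}{\alpha}\log(1+\alpha t)\right)$, interpreted as $e^{ct}$ when $\alpha=0$. The higher order degenerate Euler polynomials $\mathcal{E}_n^{(s)}(\alpha;x)$ are defined by $$\sum_{n=0}^{\infty}\mathcal{E}_{n}^{(s)}(\alpha;x)\frac{t^{n}}{n!}=\left(\frac{2}{(1+\alpha t)^{1/\alpha}+1}\right)^{s}(1+\alpha t)^{x/\alpha},$$ and $\mathcal{E}_n(\alpha;x)=\mathcal{E}_n^{(1)}(\alpha;x)$ are the degenerate Euler polynomials. Howard's degenerate weighted Stirling numbers of the second kind $S_2(n,k,r\mid\alpha)$ are defined by $$\left((1+\alpha t)^{1/\alpha}-1\right)^{k}(1+\alpha t)^{r/\alpha}=k!\sum_{n=0}^{\infty}S_{2}(n,k,r\mid\alpha)\frac{t^{n}}{n!}.$$ The rising factorial is $\langle y\rangle_{0}=1$, $\langle y\rangle_{k}=y(y+1)\cdots(y+k-1)$. *)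

theory Defs
  imports Complex_Main "HOL-Computational_Algebra.Formal_Power_Series"
begin

text \<open>
  The power \<open>F\<^sup>c = exp (c log F)\<close> of a formal power series \<open>F\<close> with constant term 1;
  \<open>fps_ln 1\<close> is the series of \<open>log (1 + t)\<close>, so that \<open>log F\<close> is its composition with \<open>F - 1\<close>.
  For series with another constant term the value has no meaning.
\<close>

definition fps_cpow :: "complex fps \<Rightarrow> complex \<Rightarrow> complex fps" where
  "fps_cpow F c = fps_exp c oo (fps_ln 1 oo (F - 1))"

text \<open>The series \<open>(1 + \<alpha> t)\<close> raised to the power \<open>c / \<alpha>\<close>, which is \<open>exp (c t)\<close> for \<open>\<alpha> = 0\<close>.\<close>

definition degen_exp :: "complex \<Rightarrow> complex \<Rightarrow> complex fps" where
  "degen_exp \<alpha> c =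
     (if \<alpha> = 0 then fps_exp c else fps_cpow (1 + fps_const \<alpha> * fps_X) (c / \<alpha>))"

definition degen_euler_gf :: "real \<Rightarrow> complex \<Rightarrow> complex \<Rightarrow> complex fps" where
  "degen_euler_gf s \<alpha> x =
     fps_cpow (2 / (degen_exp \<alpha> 1 + 1)) (complex_of_real s) * degen_exp \<alpha> x"

definition higher_degen_euler :: "nat \<Rightarrow> real \<Rightarrow> complex \<Rightarrow> complex \<Rightarrow> complex" where
  "higher_degen_euler n s \<alpha> x = fact n * fps_nth (degen_euler_gf s \<alpha> x) n"

definition degen_euler :: "nat \<Rightarrow> complex \<Rightarrow> complex \<Rightarrow> complex" where
  "degen_euler n \<alpha> x = higher_degen_euler n 1 \<alpha> x"

text \<open>Howard's numbers \<open>S\<^sub>2(n, k, r | \<alpha>)\<close>, with arguments in this order.\<close>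

definition degen_weighted_Stirling2 :: "nat \<Rightarrow> nat \<Rightarrow> complex \<Rightarrow> complex \<Rightarrow> complex" where
  "degen_weighted_Stirling2 n k r \<alpha> =
     fact n / fact k * fps_nth ((degen_exp \<alpha> 1 - 1) ^ k * degen_exp \<alpha> r) n"

lemma higher_degen_euler_gf:
  "Abs_fps (\<lambda>n. higher_degen_euler n s \<alpha> x / fact n) =
     fps_cpow (2 / (degen_exp \<alpha> 1 + 1)) (complex_of_real s) * degen_exp \<alpha> x"
  by (simp add: fps_eq_iff higher_degen_euler_def degen_euler_gf_def)

lemma degen_weighted_Stirling2_gf:
  "(degen_exp \<alpha> 1 - 1) ^ k * degen_exp \<alpha> r =
     fps_const (fact k) * Abs_fps (\<lambda>n. degen_weighted_Stirling2 n k r \<alpha> / fact n)"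
  by (simp add: fps_eq_iff degen_weighted_Stirling2_def)

lemma degen_exp_nth_0 [simp]: "fps_nth (degen_exp \<alpha> c) 0 = 1"
  by (simp add: degen_exp_def fps_cpow_def)

lemma degen_euler_base_nth_0: "fps_nth (2 / (degen_exp \<alpha> 1 + 1)) 0 = 1"
  by (simp add: fps_divide_unit fps_numeral_nth_0)

end

theory Submission
  imports Defs
begin

unbundle fps_syntax

text \<open>
  With \<open>W = ((1 + \<alpha> t)\<^bsup>1/\<alpha>\<^esup> - 1) / 2\<close> the base \<open>2 / ((1 + \<alpha> t)\<^bsup>1/\<alpha>\<^esup> + 1)\<close> is \<open>(1 + W)\<^bsup>-1\<^esup>\<close>, so its
  power with exponent \<open>c\<close> is the binomial series of exponent \<open>-c\<close> in \<open>W\<close>, and the powers of \<open>W\<close> generate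
  the weighted Stirling numbers.
\<close>

text \<open>Both series solve (1 + t) f' = c f with constant term 1, and
  \<open>fps_binomial_ODE_unique\<close> says that this determines f.\<close>

lemma fps_exp_compose_ln:
  fixes c :: "'a::field_char_0"
  shows "fps_exp c oo fps_ln 1 = fps_binomial c"
proof -
  have "fps_deriv (fps_exp c oo fps_ln 1) = fps_const c * (fps_exp c oo fps_ln 1) / (1 + fps_X)"
    by (simp add: fps_compose_deriv fps_ln_deriv fps_compose_mult_distrib fps_divide_unit)
  hence "fps_exp c oo fps_ln 1 = fps_const ((fps_exp c oo fps_ln 1) $ 0) * fps_binomial c"
    by (simp only: fps_binomial_ODE_unique)
  thus ?thesis by simp
qed

lemma fps_cpow_conv_binomial:
  assumes "F $ 0 = 1"
  shows "fps_cpow F c = fps_binomial c oo (F - 1)"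
  using assms unfolding fps_cpow_def
  by (simp add: fps_compose_assoc fps_exp_compose_ln [symmetric])

text \<open>This is the power law ((1 + t)^(-1))^c = (1 + t)^(-c). It follows from the same
  differential equation, now with -c in place of c.\<close>

lemma fps_binomial_compose_inverse:
  fixes c :: "'a::field_char_0"
  shows "fps_binomial c oo (inverse (1 + fps_X) - 1) = fps_binomial (-c)"
proof -
  define V :: "'a fps" where "V = inverse (1 + fps_X) - 1"
  define h where "h = fps_binomial c oo V"
  have V0: "V $ 0 = 0" by (simp add: V_def)
  have [simp]: "inverse (1 + fps_X) * (1 + fps_X) = (1 :: 'a fps)"
    by (rule inverse_mult_eq_1) simp
  \<comment> \<open>Since 1 + \<open>V\<close> is itself the inverse of 1 + t, inverting it gives
    back 1 + t.\<close>
  have "(inverse (1 + fps_X) oo V) = inverse (1 + V)"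
    using V0 by (simp add: fps_inverse_compose fps_compose_add_distrib)
  also have "\<dots> = 1 + fps_X"
    by (simp add: V_def fps_inverse_idempotent)
  finally have inv: "(inverse (1 + fps_X) oo V) = 1 + fps_X" .
  have dV: "fps_deriv V = - (inverse (1 + fps_X))\<^sup>2"
    by (simp add: V_def fps_inverse_deriv)
  have "fps_deriv h = (fps_const c * fps_binomial c * inverse (1 + fps_X) oo V) * fps_deriv V"
    using V0 by (simp add: h_def fps_compose_deriv fps_binomial_deriv fps_divide_unit)
  also have "\<dots> = fps_const c * h * (1 + fps_X) * (- (inverse (1 + fps_X))\<^sup>2)"
    using V0 by (simp add: fps_compose_mult_distrib inv dV h_def)
  also have "\<dots> = - fps_const c * h * inverse (1 + fps_X) * (inverse (1 + fps_X) * (1 + fps_X))"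
    by algebra
  also have "\<dots> = fps_const (-c) * h / (1 + fps_X)"
    by (simp add: fps_divide_unit)
  finally have "h = fps_const (h $ 0) * fps_binomial (-c)"
    by (simp only: fps_binomial_ODE_unique)
  thus ?thesis by (simp add: h_def V_def)
qed

text \<open>Substituting \<open>W\<close> for t in the previous power law gives the claim, by
  associativity of composition.\<close>

lemma fps_cpow_inverse:
  assumes "W $ 0 = 0"
  shows "fps_cpow (inverse (1 + W)) c = fps_binomial (-c) oo W"
proof -
  have "fps_cpow (inverse (1 + W)) c = fps_binomial c oo (inverse (1 + W) - 1)"
    using assms by (intro fps_cpow_conv_binomial) simp
  also have "inverse (1 + W) - 1 = (inverse (1 + fps_X) - 1) oo W"
    using assms by (simp add: fps_compose_sub_distrib fps_inverse_compose fps_compose_add_distrib)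
  also have "fps_binomial c oo \<dots> = fps_binomial (-c) oo W"
    using assms by (simp add: fps_compose_assoc fps_binomial_compose_inverse)
  finally show ?thesis .
qed

text \<open>As \<open>W ^ k\<close> starts at order k or later, only k \<le> n contributes to
  coefficient n; the rest is an exchange of finite sums.\<close>

lemma fps_compose_mult_nth:
  fixes a W E :: "'a::comm_ring_1 fps"
  assumes "W $ 0 = 0"
  shows "((a oo W) * E) $ n = (\<Sum>k=0..n. a $ k * (W ^ k * E) $ n)"
proof -
  \<comment> \<open>The sum for coefficient i stops at k = i. Padding it with zero terms up to n
    gives a range independent of i, so that the sums can be swapped.\<close>
  have "(a oo W) $ i = (\<Sum>k=0..n. a $ k * (W ^ k) $ i)" if "i \<le> n" for i
    unfolding fps_compose_nth
    by (rule sum.mono_neutral_left) (use that startsby_zero_power_prefix [OF assms] in auto)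
  hence "((a oo W) * E) $ n = (\<Sum>i=0..n. (\<Sum>k=0..n. a $ k * (W ^ k) $ i) * E $ (n - i))"
    by (simp add: fps_mult_nth)
  also have "\<dots> = (\<Sum>i=0..n. \<Sum>k=0..n. a $ k * ((W ^ k) $ i * E $ (n - i)))"
    by (simp add: sum_distrib_right mult.assoc)
  also have "\<dots> = (\<Sum>k=0..n. a $ k * (W ^ k * E) $ n)"
    by (subst sum.swap) (simp add: fps_mult_nth sum_distrib_left)
  finally show ?thesis .
qed

lemma higher_degen_euler_conv_Stirling2:
  "higher_degen_euler n s \<alpha> r =
     (\<Sum>k=0..n. degen_weighted_Stirling2 n k r \<alpha> *
        ((-1) ^ k * complex_of_real (pochhammer s k) / 2 ^ k))"
proof -
  define G where "G = degen_exp \<alpha> 1"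
  define W where "W = fps_const (1 / 2) * (G - 1)"
  have W0: "W $ 0 = 0" by (simp add: W_def G_def)
  have two: "2 = fps_const (2 :: complex)" by (simp add: numeral_fps_const)
  have "2 * W = G - 1"
    unfolding two W_def by (simp flip: mult.assoc)
  hence "G + 1 = 2 * (1 + W)" by (simp add: algebra_simps)
  hence "2 / (G + 1) = inverse (1 + W)"
    using W0 by (simp add: fps_divide_unit fps_inverse_mult fps_numeral_nth_0 two fps_const_inverse
        flip: mult.assoc)
  hence "higher_degen_euler n s \<alpha> r =
      fact n * ((fps_binomial (- of_real s) oo W) * degen_exp \<alpha> r) $ n"
    using W0 by (simp add: higher_degen_euler_def degen_euler_gf_def fps_cpow_inverse flip: G_def)
  also have "\<dots> = (\<Sum>k=0..n. fact n *
      ((- of_real s gchoose k) * (W ^ k * degen_exp \<alpha> r) $ n))"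
    by (simp add: fps_compose_mult_nth [OF W0] sum_distrib_left)
  also have "\<dots> = (\<Sum>k=0..n. degen_weighted_Stirling2 n k r \<alpha> *
        ((-1) ^ k * complex_of_real (pochhammer s k) / 2 ^ k))"
  proof (rule sum.cong)
    fix k
    have "W ^ k = fps_const ((1 / 2) ^ k) * (G - 1) ^ k"
      by (simp add: W_def power_mult_distrib fps_const_power)
    hence "(W ^ k * degen_exp \<alpha> r) $ n = ((G - 1) ^ k * degen_exp \<alpha> r) $ n / 2 ^ k"
      by (simp add: mult.assoc power_divide)
    \<comment> \<open>The binomial coefficient of -s over k is (-1)^k \<open>pochhammer s k\<close>
      / k!; the k! is absorbed by the Stirling number.\<close>
    thus "fact n * ((- of_real s gchoose k) * (W ^ k * degen_exp \<alpha> r) $ n) =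
        degen_weighted_Stirling2 n k r \<alpha> *
          ((-1) ^ k * complex_of_real (pochhammer s k) / 2 ^ k)"
      by (simp add: degen_weighted_Stirling2_def gbinomial_pochhammer pochhammer_of_real G_def)
  qed simp
  finally show ?thesis .
qed

theorem corollary2:
  fixes \<alpha> r :: complex
  shows "(\<forall>(s::real) (n::nat). s \<ge> 0 \<longrightarrow>
            higher_degen_euler n (s + 1) \<alpha> r =
              (\<Sum>k=0..n. degen_weighted_Stirling2 n k r \<alpha> *
                 ((-1) ^ k * complex_of_real (pochhammer (s + 1) k) / 2 ^ k)))
       \<and> (\<forall>n::nat. degen_euler n \<alpha> r =
              (\<Sum>k=0..n. degen_weighted_Stirling2 n k r \<alpha> * ((-1) ^ k * fact k / 2 ^ k)))"
  \<comment> \<open>The exponents are s + 1 and 1; for the latter, \<open>pochhammer 1 k\<close> is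
    k!.\<close>
  by (simp add: degen_euler_def higher_degen_euler_conv_Stirling2 flip: pochhammer_fact)

end
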